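(* Let $L_1,\dots,L_m\in\mathcal{L}_*$. If $\tilde{L}_i = JL_i^{-1}J$, $i=1,2,\dots,m$, then \[ \mathcal{I}\tilde{L}(x) = J\left(\mathcal{I}L(x)\right)^{-1}J \] for every $x \in \Omega$.
   Context: Let $n$ be a positive integer and $p,q\ge 0$ integers with $p+q=n$. Let $J=\mathrm{diag}(-1,\dots,-1,1,\dots,1)\in\mathbb{R}^{n\times n}$ with $p$ entries $-1$ and $q$ entries $1$. Let $\mathcal{L}$ be the set of nonsingular symmetric real $n\times n$ matrices with exactly $q$ positive and $p$ negative eigenvalues, and let $\mathcal{L}_*$ be the set of $L\in\mathcal{L}$ such that $LJ$ has no negative real eigenvalues. Let $\Omega\subset\mathbb{R}^d$ be a domain with points $x^{(1)},\dots,x^{(m)}\in\Omega$ and let $\phi_i:\Omega\to\mathbb{R}$, $i=1,\dots,m$, be functions satisfying $\phi_i(x^{(j)})=\delta_{ij}$. For matrices $L_1,\dots,L_m\in\mathcal{L}_*$ define the interpolant \[ \mathcal{I}L(x)=\exp\left(\sum_{i=1}^m\phi_i(x)\log(L_iJ)\right)J,\qquad x\in\Omega, \] where $\exp$ is the matrix exponential and $\log$ the principal matrix logarithm. $\mathcal{I}\tilde L$ denotes the interpolant defined by the same formula with $L_i$ replaced by $\tilde L_i$. *)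

theory Defs
  imports "HOL-Analysis.Analysis" "HOL-Computational_Algebra.Polynomial"
begin

text \<open>
  Matrices of size \<open>n\<close> have entries indexed by a finite linearly ordered type with \<open>n\<close> elements;
  the order makes sense of ``the first \<open>p\<close> diagonal entries''.
\<close>

definition sigJ :: "nat \<Rightarrow> real^('n::{finite,linorder})^('n::{finite,linorder})" where
  "sigJ p = (\<chi> i j. if i = j then (if card {k. k < i} < p then - 1 else 1) else 0)"

definition eigenvalue :: "'a::field^'n^'n \<Rightarrow> 'a \<Rightarrow> bool" where
  "eigenvalue A c \<longleftrightarrow> (\<exists>v. v \<noteq> 0 \<and> A *v v = c *s v)"

definition charpoly :: "'a::field^'n^'n \<Rightarrow> 'a poly" where
  "charpoly A = det (\<chi> i j. (if i = j then [:0, 1:] else 0) - [:A $ i $ j:])"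

text \<open>Eigenvalues are counted with algebraic multiplicity.\<close>

definition num_eigenvalues :: "(real \<Rightarrow> bool) \<Rightarrow> real^'n^'n \<Rightarrow> nat" where
  "num_eigenvalues P A = (\<Sum>c\<in>{c. eigenvalue A c \<and> P c}. order c (charpoly A))"

definition calL :: "nat \<Rightarrow> nat \<Rightarrow> (real^'n^'n) set" where
  "calL p q = {L. invertible L \<and> transpose L = L \<and>
     num_eigenvalues (\<lambda>c. c > 0) L = q \<and> num_eigenvalues (\<lambda>c. c < 0) L = p}"

definition calL_star :: "nat \<Rightarrow> nat \<Rightarrow> (real^('n::{finite,linorder})^('n::{finite,linorder})) set" where
  "calL_star p q = {L \<in> calL p q. \<not> (\<exists>c<0. eigenvalue (L ** sigJ p) c)}"

text \<open>
  The power series is written out because the library exponential needs a normed algebra, which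
  the type of square matrices with the product \<open>**\<close> is not.
\<close>

definition mexp :: "real^'n^'n \<Rightarrow> real^'n^'n" where
  "mexp A = (\<Sum>k. (1 / fact k) *\<^sub>R (((**) A ^^ k) (mat 1)))"

text \<open>
  The principal logarithm of a matrix \<open>A\<close> without eigenvalues on the closed negative real axis is
  the unique logarithm of \<open>A\<close> whose (complex) eigenvalues all lie in the open strip
  \<open>-pi < Im z < pi\<close>. For real \<open>A\<close> it is a real matrix, so it suffices to range over real
  matrices. For all other \<open>A\<close> the value is unspecified.
\<close>

definition mlog :: "real^'n^'n \<Rightarrow> real^'n^'n" where
  "mlog A = (THE X. mexp X = A \<and>
     (\<forall>z. eigenvalue (map_matrix complex_of_real X) z \<longrightarrow> - pi < Im z \<and> Im z < pi))"

definition interpolant ::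
  "nat \<Rightarrow> nat \<Rightarrow> (nat \<Rightarrow> 'a \<Rightarrow> real) \<Rightarrow> (nat \<Rightarrow> real^('n::{finite,linorder})^('n::{finite,linorder})) \<Rightarrow>
    'a \<Rightarrow> real^('n::{finite,linorder})^('n::{finite,linorder})" where
  "interpolant p m \<phi> L x = mexp (\<Sum>i=1..m. \<phi> i x *\<^sub>R mlog (L i ** sigJ p)) ** sigJ p"

end

(* Since J J = 1, L'_i J is the inverse of L_i J, so everything reduces to
   log (A^-1) = - log A for real A without eigenvalues in (-oo, 0]. As log is a definite description,
   this needs existence and uniqueness of the principal logarithm. Existence: with
   C = A - 1 and F(s) the integral of C (1 + t C)^-1 over 0 <= t <= s, the function
   exp(- F(s)) (1 + s C) has derivative 0, so X = F(1) is a logarithm; on a common eigenvector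
   of A and X the integral becomes the scalar one, so the eigenvalues of X are the values of Ln at
   eigenvalues of A. Uniqueness: any other principal logarithm Y commutes with A, hence with X, and
   N = X - Y satisfies exp N = 1 and has 0 as its only complex eigenvalue. If N were nonzero, its
   range would contain some v = N w, v nonzero, with N v = 0, and then w = exp(N) w = w + v. *)
theory Submission
  imports Defs "HOL-Computational_Algebra.Fundamental_Theorem_Algebra"
begin

section \<open>The matrix exponential\<close>

lemma matrix_add_rdistrib: "(A + B) ** C = A ** C + B ** (C :: 'a::semiring_1^_^_)"
  by (vector matrix_matrix_mult_def sum.distrib[symmetric] distrib_right)

lemma bounded_bilinear_matrix_mult:
  "bounded_bilinear ((**) :: real^'n^'m \<Rightarrow> real^'k^'n \<Rightarrow> real^'k^'m)"
  unfolding bilinear_conv_bounded_bilinear[symmetric] bilinear_def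
  by (auto intro!: linearI simp: matrix_add_ldistrib matrix_add_rdistrib scalar_matrix_assoc
      matrix_scalar_ac)

interpretation matrix_mult:
  bounded_bilinear "(**) :: real^'n^'m \<Rightarrow> real^'k^'n \<Rightarrow> real^'k^'m"
  by (rule bounded_bilinear_matrix_mult)

text \<open>
  The operator norm, unlike the norm of \<^typ>\<open>real^'n^'n\<close>, gives the identity norm 1, as the
  exponential of the library needs.
\<close>

typedef (overloaded) 'n sqmat = "UNIV :: (real^'n^'n) set"
  morphisms of_sqmat to_sqmat ..

setup_lifting type_definition_sqmat

instantiation sqmat :: (finite) real_normed_algebra_1
begin

lift_definition zero_sqmat :: "'a sqmat" is 0 .
lift_definition one_sqmat :: "'a sqmat" is "mat 1" .
lift_definition plus_sqmat :: "'a sqmat \<Rightarrow> 'a sqmat \<Rightarrow> 'a sqmat" is "(+)" .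
lift_definition minus_sqmat :: "'a sqmat \<Rightarrow> 'a sqmat \<Rightarrow> 'a sqmat" is "(-)" .
lift_definition uminus_sqmat :: "'a sqmat \<Rightarrow> 'a sqmat" is uminus .
lift_definition times_sqmat :: "'a sqmat \<Rightarrow> 'a sqmat \<Rightarrow> 'a sqmat" is "(**)" .
lift_definition scaleR_sqmat :: "real \<Rightarrow> 'a sqmat \<Rightarrow> 'a sqmat" is "(*\<^sub>R)" .
lift_definition norm_sqmat :: "'a sqmat \<Rightarrow> real" is "\<lambda>A. onorm ((*v) A)" .

definition dist_sqmat :: "'a sqmat \<Rightarrow> 'a sqmat \<Rightarrow> real"
  where "dist_sqmat A B = norm (A - B)"

definition sgn_sqmat :: "'a sqmat \<Rightarrow> 'a sqmat"
  where "sgn_sqmat A = inverse (norm A) *\<^sub>R A"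

definition uniformity_sqmat :: "('a sqmat \<times> 'a sqmat) filter"
  where "uniformity_sqmat = (INF e\<in>{0<..}. principal {(A, B). dist A B < e})"

definition open_sqmat :: "'a sqmat set \<Rightarrow> bool"
  where "open_sqmat U = (\<forall>A\<in>U. eventually (\<lambda>(A', B). A' = A \<longrightarrow> B \<in> U) uniformity)"

instance
proof
  fix A B C :: "'a sqmat" and a b :: real
  show "A + B + C = A + (B + C)" "A + B = B + A" "0 + A = A" "- A + A = 0" "A - B = A + - B"
    by (transfer, simp)+
  show "a *\<^sub>R (A + B) = a *\<^sub>R A + a *\<^sub>R B" "(a + b) *\<^sub>R A = a *\<^sub>R A + b *\<^sub>R A"
    "a *\<^sub>R b *\<^sub>R A = (a * b) *\<^sub>R A" "1 *\<^sub>R A = A"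
    by (transfer, simp add: algebra_simps)+
  show "A * B * C = A * (B * C)"
    by transfer (simp add: matrix_mul_assoc)
  show "(A + B) * C = A * C + B * C" "A * (B + C) = A * B + A * C"
    by (transfer, simp add: matrix_add_ldistrib matrix_add_rdistrib)+
  show "a *\<^sub>R A * B = a *\<^sub>R (A * B)" "A * a *\<^sub>R B = a *\<^sub>R (A * B)"
    by (transfer, simp add: scalar_matrix_assoc matrix_scalar_ac)+
  show "1 * A = A" "A * 1 = A"
    by (transfer, simp)+
  show "(0::'a sqmat) \<noteq> 1"
    by transfer (simp add: mat_def vec_eq_iff)
  show "dist A B = norm (A - B)" "sgn A = inverse (norm A) *\<^sub>R A"
    by (simp_all add: dist_sqmat_def sgn_sqmat_def)
  show "norm A = 0 \<longleftrightarrow> A = 0"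
    by transfer (auto simp: onorm_eq_0 matrix_eq)
  show "norm (A + B) \<le> norm A + norm B"
    by transfer (use onorm_triangle[OF matrix_vector_mul_bounded_linear matrix_vector_mul_bounded_linear]
      in \<open>simp add: matrix_vector_mult_add_rdistrib[abs_def]\<close>)
  show "norm (a *\<^sub>R A) = \<bar>a\<bar> * norm A"
    by transfer (use onorm_scaleR[OF matrix_vector_mul_bounded_linear]
      in \<open>simp add: scaleR_matrix_vector_assoc[symmetric, abs_def]\<close>)
  show "norm (A * B) \<le> norm A * norm B"
    by transfer (use onorm_compose[OF matrix_vector_mul_bounded_linear matrix_vector_mul_bounded_linear]
      in \<open>simp add: o_def matrix_vector_mul_assoc\<close>)
  show "norm (1 :: 'a sqmat) = 1"
    by transfer (use onorm_id in \<open>simp add: matrix_vector_mul_lid[abs_def]\<close>)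
  show "uniformity = (INF e\<in>{0<..}. principal {(A :: 'a sqmat, B). dist A B < e})"
    by (simp add: uniformity_sqmat_def)
  show "open U = (\<forall>A\<in>U. eventually (\<lambda>(A', B). A' = A \<longrightarrow> B \<in> U) uniformity)" for U :: "'a sqmat set"
    by (simp add: open_sqmat_def)
qed

end

lemma bounded_linear_to_sqmat: "bounded_linear (to_sqmat :: real^'n^'n \<Rightarrow> 'n sqmat)"
  unfolding linear_conv_bounded_linear[symmetric]
  by (rule linearI; transfer; simp)

text \<open>Each entry of a matrix is bounded by its operator norm, so the Euclidean norm is at most
  n * n times the operator norm. Together with \<open>bounded_linear_to_sqmat\<close> this lets
  completeness pass from \<open>real^'n^'n\<close> to the new type.\<close>

lemma bounded_linear_of_sqmat: "bounded_linear (of_sqmat :: 'n sqmat \<Rightarrow> real^'n^'n)"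
proof (rule bounded_linear_intro)
  fix A B :: "'n sqmat" and r :: real
  show "of_sqmat (A + B) = of_sqmat A + of_sqmat B" "of_sqmat (r *\<^sub>R A) = r *\<^sub>R of_sqmat A"
    by (transfer, simp)+
  have "norm (of_sqmat A) \<le> (\<Sum>i\<in>UNIV. norm (of_sqmat A $ i))"
    unfolding norm_vec_def by (rule L2_set_le_sum) simp
  also have "\<dots> \<le> (\<Sum>i\<in>(UNIV::'n set). \<Sum>j\<in>(UNIV::'n set). \<bar>of_sqmat A $ i $ j\<bar>)"
    by (intro sum_mono norm_le_l1_cart)
  also have "\<dots> \<le> (\<Sum>i\<in>(UNIV::'n set). \<Sum>j\<in>(UNIV::'n set). norm A)"
    by (intro sum_mono) (transfer, rule matrix_component_le_onorm)
  finally show "norm (of_sqmat A) \<le> norm A * (real CARD('n) * real CARD('n))"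
    by (simp add: mult_ac)
qed

instance sqmat :: (finite) banach
proof
  fix X :: "nat \<Rightarrow> 'a sqmat"
  assume "Cauchy X"
  then have "Cauchy (\<lambda>n. of_sqmat (X n))"
    by (rule bounded_linear.Cauchy[OF bounded_linear_of_sqmat])
  then obtain A where "(\<lambda>n. of_sqmat (X n)) \<longlonglongrightarrow> A"
    using Cauchy_convergent_iff convergent_def by blast
  then have "(\<lambda>n. to_sqmat (of_sqmat (X n))) \<longlonglongrightarrow> to_sqmat A"
    by (rule bounded_linear.tendsto[OF bounded_linear_to_sqmat])
  then show "convergent X"
    by (auto simp: of_sqmat_inverse convergent_def)
qed

section \<open>Transfer of the exponential of a Banach algebra to \<open>mexp\<close>\<close>

lemma of_sqmat_simps:
  "of_sqmat 0 = 0" "of_sqmat 1 = mat 1" "of_sqmat (X + Y) = of_sqmat X + of_sqmat Y"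
  "of_sqmat (X - Y) = of_sqmat X - of_sqmat Y"
  "of_sqmat (X * Y) = of_sqmat X ** of_sqmat Y" "of_sqmat (r *\<^sub>R X) = r *\<^sub>R of_sqmat X"
  by (transfer, simp)+

lemma to_sqmat_simps:
  "to_sqmat 0 = 0" "to_sqmat (A + B) = to_sqmat A + to_sqmat B"
  "to_sqmat (A - B) = to_sqmat A - to_sqmat B" "to_sqmat (A ** B) = to_sqmat A * to_sqmat B"
  by (transfer, simp)+

lemma of_sqmat_power: "of_sqmat (X ^ k) = (((**) (of_sqmat X)) ^^ k) (mat 1)"
  by (induction k) (simp_all add: of_sqmat_simps)

text \<open>The linear map \<open>of_sqmat\<close> carries the exponential series of the Banach
  algebra termwise to the series in the definition of \<open>mexp\<close>. This also shows that the
  infinite sum there converges, so that it is not a default value.\<close>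

lemma mexp_sums:
  "(\<lambda>k. (1 / fact k) *\<^sub>R (((**) A ^^ k) (mat 1))) sums mexp (A :: real^'n^'n)"
  and mexp_eq_exp: "mexp A = of_sqmat (exp (to_sqmat A))"
proof -
  have "(\<lambda>k. of_sqmat (to_sqmat A ^ k /\<^sub>R fact k)) sums of_sqmat (exp (to_sqmat A))"
    by (rule bounded_linear.sums[OF bounded_linear_of_sqmat exp_converges])
  then have *: "(\<lambda>k. (1 / fact k) *\<^sub>R (((**) A ^^ k) (mat 1))) sums of_sqmat (exp (to_sqmat A))"
    by (simp add: of_sqmat_simps of_sqmat_power to_sqmat_inverse inverse_eq_divide)
  then show "mexp A = of_sqmat (exp (to_sqmat A))"
    by (simp add: mexp_def sums_unique[symmetric])
  with * show "(\<lambda>k. (1 / fact k) *\<^sub>R (((**) A ^^ k) (mat 1))) sums mexp A"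
    by simp
qed

lemma mexp_0 [simp]: "mexp 0 = mat 1"
  by (simp add: mexp_eq_exp to_sqmat_simps of_sqmat_simps)

lemma mexp_add:
  assumes "A ** B = B ** A"
  shows "mexp (A + B) = mexp A ** mexp B"
proof -
  have "to_sqmat A * to_sqmat B = to_sqmat B * to_sqmat A"
    using assms by (metis to_sqmat_simps(4))
  from exp_add_commuting[OF this] show ?thesis
    by (simp add: mexp_eq_exp to_sqmat_simps of_sqmat_simps)
qed

lemma mexp_minus: "mexp (- A) ** mexp A = mat 1" "mexp A ** mexp (- A) = mat 1"
proof -
  have "A ** - A = - A ** A"
    by (simp add: matrix_mult.minus_left matrix_mult.minus_right)
  from mexp_add[OF this] mexp_add[OF this[symmetric]]
  show "mexp (- A) ** mexp A = mat 1" "mexp A ** mexp (- A) = mat 1"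
    by simp_all
qed

lemma mexp_commute: "mexp A ** A = A ** mexp A"
  using arg_cong[OF exp_times_arg_commute[of "to_sqmat A"], of of_sqmat]
  by (simp add: mexp_eq_exp of_sqmat_simps to_sqmat_inverse)

text \<open>The terms of degree at least 2 are dominated by those of the scalar series at r =
  \<open>norm h\<close>, and exp r - 1 - r is at most r^2 for r in [0, 1]. Only the point 0 is
  treated, since away from it noncommutativity spoils the simple formula.\<close>

lemma exp_has_derivative_at_0:
  "(exp has_derivative (\<lambda>h. h)) (at (0 :: 'a :: {real_normed_algebra_1,banach}))"
proof -
  have bound: "norm (exp h - 1 - h) \<le> (norm h)\<^sup>2" if "norm h \<le> 1" for h :: 'a
  proof -
    have s: "summable (\<lambda>n. inverse (fact (n + 2)) *\<^sub>R norm h ^ (n + 2))"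
      using summable_ignore_initial_segment[OF summable_exp_generic[of "norm h"], of 2] by simp
    have "norm (exp h - 1 - h) = norm (\<Sum>n. inverse (fact (n + 2)) *\<^sub>R (h ^ (n + 2)))"
      by (simp add: exp_first_two_terms[of h])
    also have "\<dots> \<le> (\<Sum>n. inverse (fact (n + 2)) *\<^sub>R norm h ^ (n + 2))"
      by (rule norm_suminf_le[OF _ s]) (auto intro!: mult_left_mono norm_power_ineq simp del: power_Suc)
    also have "\<dots> = exp (norm h) - 1 - norm h"
      by (subst exp_first_two_terms[of "norm h"]) simp
    also have "\<dots> \<le> (norm h)\<^sup>2"
      using exp_bound[of "norm h"] that by simp
    finally show ?thesis .
  qed
  show ?thesis
  proof (rule has_derivativeI_sandwich[of 1])
    show "((\<lambda>y :: 'a. norm y) \<longlongrightarrow> 0) (at 0)"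
      by (intro tendsto_eq_intros) auto
    fix y :: 'a assume "y \<noteq> 0" "dist y 0 < 1"
    then show "norm (exp y - exp 0 - (y - 0)) / norm (y - 0) \<le> norm y"
      using bound[of y] by (simp add: divide_simps power2_eq_square)
  qed auto
qed

lemma mexp_has_derivative_at_0: "(mexp has_derivative (\<lambda>h. h)) (at 0)"
proof -
  have "((\<lambda>A. of_sqmat (exp (to_sqmat A))) has_derivative (\<lambda>h. of_sqmat (to_sqmat h)))
    (at (0 :: real^'n^'n))"
    by (intro bounded_linear.has_derivative[OF bounded_linear_of_sqmat]
        has_derivative_compose[OF bounded_linear.has_derivative[OF bounded_linear_to_sqmat has_derivative_ident]])
      (simp add: to_sqmat_simps exp_has_derivative_at_0)
  then show ?thesis
    by (simp add: mexp_eq_exp[symmetric] to_sqmat_inverse)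
qed

text \<open>As \<open>F t\<close> commutes with \<open>F s\<close>, the factor
  \<open>mexp (F s)\<close> splits off from \<open>mexp (F t)\<close>. What remains is
  \<open>mexp (F t - F s)\<close>, whose argument tends to 0, where the derivative of
  \<open>mexp\<close> is the identity.\<close>

lemma mexp_has_vector_derivative:
  assumes F: "(F has_vector_derivative D) (at s within S)" and "s \<in> S"
    and comm: "\<And>t. t \<in> S \<Longrightarrow> F s ** F t = F t ** F s"
  shows "((\<lambda>t. mexp (F t)) has_vector_derivative mexp (F s) ** D) (at s within S)"
proof -
  have "((\<lambda>t. mexp (F t - F s)) has_derivative (\<lambda>x. x *\<^sub>R D)) (at s within S)"
  proof (rule has_derivative_compose[where f = "\<lambda>t. F t - F s" and g = mexp])
    show "((\<lambda>t. F t - F s) has_derivative (\<lambda>x. x *\<^sub>R D)) (at s within S)"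
      using F by (auto simp: has_vector_derivative_def intro!: derivative_eq_intros)
    show "(mexp has_derivative (\<lambda>h. h)) (at (F s - F s))"
      using mexp_has_derivative_at_0 by simp
  qed
  then have "((\<lambda>t. mexp (F t - F s)) has_vector_derivative D) (at s within S)"
    by (simp add: has_vector_derivative_def)
  then have *: "((\<lambda>t. mexp (F s) ** mexp (F t - F s)) has_vector_derivative mexp (F s) ** D)
      (at s within S)"
    by (rule bounded_linear.has_vector_derivative[OF
          bounded_bilinear.bounded_linear_right[OF bounded_bilinear_matrix_mult]])
  have "mexp (F t) = mexp (F s) ** mexp (F t - F s)" if "t \<in> S" for t
  proof -
    have "F s ** (F t - F s) = (F t - F s) ** F s"
      using comm[OF that]
      by (simp add: matrix_mult.diff_left matrix_mult.diff_right)
    from mexp_add[OF this] show ?thesis by simp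
  qed
  from has_vector_derivative_transform[OF \<open>s \<in> S\<close> this *] show ?thesis .
qed

section \<open>Complex eigenvectors of real matrices\<close>

text \<open>This is p(M) w, computed by Horner's scheme directly on vectors, so that no polynomial
  in matrices has to be formed.\<close>

definition poly_mv :: "'a::field^'n^'n \<Rightarrow> 'a poly \<Rightarrow> 'a^'n \<Rightarrow> 'a^'n"
  where "poly_mv M p w = fold_coeffs (\<lambda>a x. a *s w + M *v x) p 0"

lemma poly_mv_0 [simp]: "poly_mv M 0 w = 0"
  by (simp add: poly_mv_def)

lemma poly_mv_pCons [simp]: "poly_mv M (pCons a p) w = a *s w + M *v poly_mv M p w"
  by (cases "p = 0 \<and> a = 0") (auto simp: poly_mv_def)

lemma poly_mv_add: "poly_mv M (p + q) w = poly_mv M p w + poly_mv M q w"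
  by (induction p q rule: poly_induct2)
    (simp_all add: matrix_vector_right_distrib vec.scale_left_distrib)

lemma poly_mv_smult: "poly_mv M (smult c p) w = c *s poly_mv M p w"
  by (induction p) (simp_all add: vec.scale_right_distrib vector_scalar_commute)

lemma poly_mv_sum: "poly_mv M (\<Sum>i\<in>I. f i) w = (\<Sum>i\<in>I. poly_mv M (f i) w)"
  by (induction I rule: infinite_finite_induct) (simp_all add: poly_mv_add)

lemma poly_mv_monom: "poly_mv M (monom c k) w = c *s (((*v) M) ^^ k) w"
  by (induction k) (simp_all add: monom_0 monom_Suc vector_scalar_commute)

text \<open>The factor M - z commutes with p(M), so it can be applied to w first. This allows roots
  to be split off one at a time.\<close>

lemma poly_mv_linear_factor:
  "poly_mv M ([:- z, 1:] * p) w = poly_mv M p (M *v w - z *s w)"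
proof (induction p)
  case (pCons a p)
  have "[:- z, 1:] * pCons a p = smult a [:- z, 1:] + pCons 0 ([:- z, 1:] * p)"
    by (simp add: mult_pCons_right algebra_simps)
  then have "poly_mv M ([:- z, 1:] * pCons a p) w
      = poly_mv M (smult a [:- z, 1:]) w + poly_mv M (pCons 0 ([:- z, 1:] * p)) w"
    by (simp only: poly_mv_add)
  also have "\<dots> = poly_mv M (pCons a p) (M *v w - z *s w)"
    by (simp only: pCons.IH poly_mv_smult poly_mv_pCons)
      (simp add: vec.scale_right_diff_distrib vector_scalar_commute)
  finally show ?case .
qed simp

text \<open>The n + 1 vectors w, M w, ..., M^n w are linearly dependent in dimension n, and the
  coefficients of a dependence are those of p.\<close>

lemma annihilating_poly_exists:
  fixes M :: "'a::field^'n^'n"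
  obtains p where "p \<noteq> 0" "poly_mv M p w = 0"
proof (cases "inj_on (\<lambda>k. (((*v) M) ^^ k) w) {..CARD('n)}")
  \<comment> \<open>Dependence is a property of the set of these vectors, which hides repetitions. A
    repetition M^i w = M^j w is therefore handled separately, by x^i - x^j.\<close>
  case False
  then obtain i j where ij: "i \<noteq> j" "(((*v) M) ^^ i) w = (((*v) M) ^^ j) w"
    by (auto simp: inj_on_def)
  have "monom (1::'a) i + smult (- 1) (monom 1 j) \<noteq> 0"
    using ij(1) by (auto simp: poly_eq_iff dest!: spec[of _ i])
  moreover have "poly_mv M (monom 1 i + smult (- 1) (monom 1 j)) w = 0"
    using ij(2) by (simp only: poly_mv_add poly_mv_smult poly_mv_monom) simp
  ultimately show thesis by (rule that)
next
  case True
  let ?f = "\<lambda>k. (((*v) M) ^^ k) w"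
  have "card (?f ` {..CARD('n)}) > CARD('n)"
    using True by (simp add: card_image)
  then have "vec.dependent (?f ` {..CARD('n)})"
    using vec.independent_card_le_dim[of "?f ` {..CARD('n)}" UNIV] by (auto simp: vec_dim_card simp del: vec.dim_UNIV)
  then obtain u k where u: "(\<Sum>v\<in>?f ` {..CARD('n)}. u v *s v) = 0" "k \<le> CARD('n)" "u (?f k) \<noteq> 0"
    by (auto simp: vec.dependent_finite)
  let ?p = "\<Sum>k\<le>CARD('n). monom (u (?f k)) k"
  have "coeff ?p k = u (?f k)"
    using u(2) by (simp add: coeff_sum)
  with u(3) have "?p \<noteq> 0" by auto
  moreover have "poly_mv M ?p w = 0"
    using u(1) by (simp add: poly_mv_sum poly_mv_monom sum.reindex[OF True])
  ultimately show thesis by (rule that)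
qed

text \<open>Induction on the degree of a polynomial p with p(M) w = 0. For a root z of p, either w
  is an eigenvector for z, or M w - z w is a nonzero vector of W that the quotient of p by x - z
  annihilates.\<close>

lemma eigenvector_in_invariant_subspace:
  fixes M :: "complex^'n^'n"
  assumes W: "vec.subspace W" and inv: "\<And>w. w \<in> W \<Longrightarrow> M *v w \<in> W"
    and w: "w \<in> W" "w \<noteq> 0"
  obtains z v where "v \<in> W" "v \<noteq> 0" "M *v v = z *s v"
proof -
  have "\<exists>z. \<exists>v\<in>W. v \<noteq> 0 \<and> M *v v = z *s v"
    if "p \<noteq> 0" "poly_mv M p w = 0" "w \<in> W" "w \<noteq> 0" for p w
    using that
  proof (induction "degree p" arbitrary: p w)
    \<comment> \<open>A nonzero constant annihilates only the zero vector, so this case is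
      contradictory.\<close>
    case 0
    then show ?case
      by (auto elim!: degree_eq_zeroE)
  next
    case (Suc n)
    then have "\<not> constant (poly p)"
      by (simp add: constant_degree)
    then obtain z where "poly p z = 0"
      using fundamental_theorem_of_algebra by blast
    then obtain q where q: "p = [:- z, 1:] * q"
      by (auto simp: poly_eq_0_iff_dvd)
    show ?case
    proof (cases "M *v w - z *s w = 0")
      case True
      with Suc.prems show ?thesis by auto
    next
      case False
      have "q \<noteq> 0"
        using Suc.prems q by auto
      moreover from this have "n = degree q"
        using Suc.hyps(2) unfolding q by (subst (asm) degree_mult_eq) auto
      moreover have "M *v w - z *s w \<in> W"
        using W inv Suc.prems by (intro vec.subspace_diff vec.subspace_scale)
      ultimately show ?thesis
        using Suc.hyps(1)[of q "M *v w - z *s w"] Suc.prems(2) False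
        by (simp only: q poly_mv_linear_factor not_False_eq_True)
    qed
  qed
  with annihilating_poly_exists[of M w] w that show thesis by metis
qed

lemma subspace_eigenspace: "vec.subspace {v. M *v v = z *s v}" for M :: "'a::field^'n^'n"
  by (auto intro!: vec.subspaceI
      simp: matrix_vector_right_distrib vec.scale_right_distrib vector_scalar_commute)

section \<open>Complexification of real matrices\<close>

abbreviation complexify :: "real^'n^'m \<Rightarrow> complex^'n^'m"
  where "complexify \<equiv> map_matrix complex_of_real"

lemma complexify_mult_vec: "complexify (A ** B) *v v = complexify A *v (complexify B *v v)"
proof -
  have "complexify (A ** B) = complexify A ** complexify B"
    by (simp add: vec_eq_iff matrix_matrix_mult_def)
  then show ?thesis
    by (simp add: matrix_vector_mul_assoc)
qed

lemma complexify_one: "complexify (mat 1) *v v = v" for v :: "complex^'n"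
proof -
  have "complexify (mat 1 :: real^'n^'n) = mat 1"
    by (simp add: vec_eq_iff mat_def)
  then show ?thesis by simp
qed

lemma bounded_linear_complexify_mult_vec: "bounded_linear (\<lambda>A. complexify A *v v)"
  unfolding linear_conv_bounded_linear[symmetric]
  by (rule linearI) (simp_all add: vec_eq_iff matrix_vector_mult_def sum.distrib distrib_left distrib_right
      scaleR_sum_right scaleR_conv_of_real[where 'a = complex] mult_ac sum_distrib_left vector_scaleR_component)

lemma complexify_add_vec: "complexify (A + B) *v v = complexify A *v v + complexify B *v v"
  by (rule linear_add[OF bounded_linear.linear[OF bounded_linear_complexify_mult_vec]])

lemma complexify_diff_vec: "complexify (A - B) *v v = complexify A *v v - complexify B *v v"
  by (rule linear_diff[OF bounded_linear.linear[OF bounded_linear_complexify_mult_vec]])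

lemma complexify_scaleR_vec: "complexify (r *\<^sub>R A) *v v = r *\<^sub>R (complexify A *v v)"
  by (rule linear_cmul[OF bounded_linear.linear[OF bounded_linear_complexify_mult_vec]])

lemma bounded_linear_vector_scalar_mult_left: "bounded_linear (\<lambda>a. a *s (v :: complex^'n))"
  unfolding linear_conv_bounded_linear[symmetric]
  by (rule linearI) (simp_all add: vec_eq_iff algebra_simps)

text \<open>Since A and r are real, the real and imaginary parts of v satisfy the eigenvector
  equation separately, and at least one of them is nonzero.\<close>

lemma eigenvalue_complexifyD:
  assumes "complexify A *v v = complex_of_real r *s v" "v \<noteq> 0"
  shows "eigenvalue A r"
proof -
  define x where "x = (\<chi> i. Re (v $ i))"
  define y where "y = (\<chi> i. Im (v $ i))"
  have e: "(\<Sum>j\<in>UNIV. complex_of_real (A $ i $ j) * v $ j) = complex_of_real r * v $ i" for i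
    using assms(1) by (simp add: vec_eq_iff matrix_vector_mult_def)
  have "A *v x = r *s x"
    using e[THEN arg_cong[of _ _ Re]] by (simp add: vec_eq_iff matrix_vector_mult_def x_def)
  moreover have "A *v y = r *s y"
    using e[THEN arg_cong[of _ _ Im]] by (simp add: vec_eq_iff matrix_vector_mult_def y_def)
  moreover have "x \<noteq> 0 \<or> y \<noteq> 0"
    using assms(2) by (auto simp: vec_eq_iff complex_eq_iff x_def y_def)
  ultimately show ?thesis
    by (auto simp: eigenvalue_def)
qed

lemma complexify_mexp_eigenvector:
  assumes "complexify A *v v = z *s v"
  shows "complexify (mexp A) *v v = exp z *s v"
proof -
  have pow: "complexify ((((**) A) ^^ k) (mat 1)) *v v = z ^ k *s v" for k
    by (induction k)
      (simp_all add: complexify_one complexify_mult_vec vector_scalar_commute assms mult_ac)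
  have "(\<lambda>k. complexify ((1 / fact k) *\<^sub>R (((**) A ^^ k) (mat 1))) *v v) sums (complexify (mexp A) *v v)"
    by (rule bounded_linear.sums[OF bounded_linear_complexify_mult_vec mexp_sums])
  moreover have "complexify ((1 / fact k) *\<^sub>R (((**) A ^^ k) (mat 1))) *v v = (z ^ k /\<^sub>R fact k) *s v" for k
    using pow[of k]
    by (simp add: complexify_scaleR_vec vec_eq_iff inverse_eq_divide)
  moreover have "(\<lambda>k. (z ^ k /\<^sub>R fact k) *s v) sums (exp z *s v)"
    by (rule bounded_linear.sums[OF bounded_linear_vector_scalar_mult_left exp_converges])
  ultimately show ?thesis
    by (simp add: sums_unique2)
qed

text \<open>All terms of the exponential series from degree 2 on vanish at v.\<close>

lemma complexify_mexp_square_zero: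
  assumes "complexify A *v (complexify A *v v) = 0"
  shows "complexify (mexp A) *v v = v + complexify A *v v"
proof -
  let ?f = "\<lambda>k. complexify ((1 / fact k) *\<^sub>R (((**) A ^^ k) (mat 1))) *v v"
  have z: "complexify ((((**) A) ^^ (Suc (Suc k))) (mat 1)) *v v = 0" for k
    by (induction k) (simp_all add: complexify_one complexify_mult_vec assms)
  have "?f sums (complexify (mexp A) *v v)"
    by (rule bounded_linear.sums[OF bounded_linear_complexify_mult_vec mexp_sums])
  moreover have "?f sums (\<Sum>k<2. ?f k)"
  proof (rule sums_finite)
    fix k :: nat assume "k \<notin> {..<2}"
    then obtain l where "k = Suc (Suc l)"
      by (metis One_nat_def Suc_1 lessThan_iff not0_implies_Suc not_less_eq zero_less_Suc)
    then show "?f k = 0"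
      using z[of l] by (simp add: complexify_scaleR_vec)
  qed simp
  ultimately show ?thesis
    by (simp add: sums_unique2 numeral_2_eq_2 complexify_one)
qed

text \<open>Y maps an eigenspace of X into itself, so after an eigenvalue of X on W is found, the
  search for an eigenvector of Y can be confined to the part of that eigenspace inside W.\<close>

lemma eigenvector_of_commuting:
  assumes comm: "X ** Y = Y ** X" and W: "vec.subspace W"
    and X: "\<And>w. w \<in> W \<Longrightarrow> complexify X *v w \<in> W"
    and Y: "\<And>w. w \<in> W \<Longrightarrow> complexify Y *v w \<in> W"
    and w: "w \<in> W" "w \<noteq> 0"
  obtains a b v where "v \<in> W" "v \<noteq> 0" "complexify X *v v = a *s v" "complexify Y *v v = b *s v"
proof -
  obtain a u where u: "u \<in> W" "u \<noteq> 0" "complexify X *v u = a *s u"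
    using eigenvector_in_invariant_subspace[OF W X w] by metis
  have *: "complexify X *v (complexify Y *v v) = complexify Y *v (complexify X *v v)" for v
    by (simp add: complexify_mult_vec[symmetric] comm)
  have "vec.subspace (W \<inter> {v. complexify X *v v = a *s v})"
    by (intro vec.subspace_inter W subspace_eigenspace)
  then obtain b v where "v \<in> W \<inter> {v. complexify X *v v = a *s v}" "v \<noteq> 0" "complexify Y *v v = b *s v"
    by (rule eigenvector_in_invariant_subspace[of _ "complexify Y" u])
      (use u Y in \<open>auto simp: * vector_scalar_commute\<close>)
  then show thesis
    using that by blast
qed

section \<open>The principal logarithm\<close>

definition principal_spectrum :: "real^'n^'n \<Rightarrow> bool"
  where "principal_spectrum X \<longleftrightarrow>
    (\<forall>z. eigenvalue (complexify X) z \<longrightarrow> - pi < Im z \<and> Im z < pi)"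

lemma principal_log_unique:
  assumes comm: "X ** Y = Y ** X" and eq: "mexp X = mexp Y"
    and X: "principal_spectrum X" and Y: "principal_spectrum Y"
  shows "X = Y"
proof (rule ccontr)
  assume "X \<noteq> Y"
  define N where "N = X - Y"
  have NX: "N ** X = X ** N"
    by (simp add: N_def matrix_mult.diff_left matrix_mult.diff_right comm)
  have "X ** - Y = - Y ** X"
    by (simp add: matrix_mult.minus_left matrix_mult.minus_right comm)
  from mexp_add[OF this] have "mexp N = mat 1"
    by (simp add: N_def eq mexp_minus)
  \<comment> \<open>The eigenvector is sought inside the range of N, because a preimage of it under
    N is needed at the end.\<close>
  define W where "W = range ((*v) (complexify N))"
  have W: "vec.subspace W"
    unfolding W_def by (rule vec.subspace_image) (simp add: vec.subspace_UNIV)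
  obtain i j where "N $ i $ j \<noteq> 0"
    using \<open>X \<noteq> Y\<close> by (auto simp: N_def vec_eq_iff)
  \<comment> \<open>Applying N to the j-th unit vector gives its j-th column, which has a nonzero
    entry; hence W is not trivial.\<close>
  then have "(complexify N *v axis j 1) $ i \<noteq> 0"
    by (simp add: matrix_vector_mult_def axis_def if_distrib cong: if_cong)
  then have w0: "complexify N *v axis j 1 \<in> W" "complexify N *v axis j 1 \<noteq> 0"
    by (auto simp: W_def)
  have WN: "complexify N *v w \<in> W" for w
    by (simp add: W_def)
  have WX: "complexify X *v w \<in> W" if "w \<in> W" for w
  proof -
    from that obtain u where "w = complexify N *v u"
      by (auto simp: W_def)
    then have "complexify X *v w = complexify N *v (complexify X *v u)"
      by (simp add: complexify_mult_vec[symmetric] NX)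
    with WN show ?thesis by simp
  qed
  from eigenvector_of_commuting[OF NX W WN WX w0]
  obtain a b v where v: "v \<in> W" "v \<noteq> 0"
    and ab: "complexify N *v v = a *s v" "complexify X *v v = b *s v"
    by blast
  have "exp a = 1"
    using complexify_mexp_eigenvector[OF ab(1)] v(2)
    unfolding \<open>mexp N = mat 1\<close> complexify_one by (metis vec.scale_cancel_right vec.scale_one)
  then obtain n :: int where n: "Re a = 0" "Im a = of_int (2 * n) * pi"
    by (auto simp: exp_eq_1)
  \<comment> \<open>Both b and b - a are now eigenvalues of matrices with principal spectrum, so the
    imaginary part of a is less than 2 pi in absolute value. Being a multiple of 2 pi, it is
    0.\<close>
  have "complexify Y *v v = (b - a) *s v"
    using ab unfolding N_def complexify_diff_vec by (simp add: vec.scale_left_diff_distrib algebra_simps)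
  then have "- pi < Im b" "Im b < pi" "- pi < Im (b - a)" "Im (b - a) < pi"
    using X Y ab(2) v(2) unfolding principal_spectrum_def eigenvalue_def by blast+
  then have "- (2 * pi) < Im a" "Im a < 2 * pi"
    by simp_all
  then have "- 1 * pi < of_int n * pi" "of_int n * pi < 1 * pi"
    unfolding n(2) by (simp_all add: mult.commute)
  then have "n = 0"
    unfolding mult_less_cancel_right_pos[OF pi_gt_zero] by linarith
  with n have "a = 0"
    by (simp add: complex_eq_iff)
  obtain w where w: "v = complexify N *v w"
    using v(1) by (auto simp: W_def)
  then have "complexify (mexp N) *v w = w + v"
    using ab(1) \<open>a = 0\<close> by (simp add: complexify_mexp_square_zero)
  with v(2) show False
    by (simp add: \<open>mexp N = mat 1\<close> complexify_one)
qed

section \<open>Matrix inverses and their continuity\<close>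

lemma matrix_inv_mult:
  fixes A :: "'a::field^'n^'n"
  assumes "invertible A"
  shows "A ** matrix_inv A = mat 1" "matrix_inv A ** A = mat 1"
proof -
  have "\<exists>B. A ** B = mat 1 \<and> B ** A = mat 1"
    using assms by (simp add: invertible_def)
  from someI_ex[OF this] show "A ** matrix_inv A = mat 1" "matrix_inv A ** A = mat 1"
    by (simp_all add: matrix_inv_def)
qed

lemma matrix_inv_unique:
  fixes A :: "'a::field^'n^'n"
  assumes "A ** B = mat 1"
  shows "matrix_inv A = B"
proof -
  have "invertible A"
    using assms by (auto simp: invertible_right_inverse)
  then have "matrix_inv A ** (A ** B) = B"
    by (simp add: matrix_mul_assoc matrix_inv_mult)
  then show ?thesis
    by (simp add: assms)
qed

text \<open>Cramer's rule for the l-th column of the inverse. It presents every entry as a quotient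
  of determinants, from which continuity can be read off.\<close>

lemma matrix_inv_component:
  fixes A :: "real^'n^'n"
  assumes "invertible A"
  shows "matrix_inv A $ k $ l
    = det (\<chi> i j. if j = k then axis l 1 $ i else A $ i $ j) / det A"
proof -
  have "A *v (matrix_inv A *v axis l 1) = axis l 1"
    by (simp add: matrix_vector_mul_assoc matrix_inv_mult assms)
  then have "matrix_inv A *v axis l 1
      = (\<chi> k. det (\<chi> i j. if j = k then axis l 1 $ i else A $ i $ j) / det A)"
    using cramer[of A] assms by (simp add: invertible_det_nz)
  then show ?thesis
    by (simp add: matrix_vector_mult_basis column_def vec_eq_iff)
qed

lemma continuous_on_det:
  assumes "\<And>i j. continuous_on S (\<lambda>t. A t $ i $ j)"
  shows "continuous_on S (\<lambda>t. det (A t :: real^'n^'n))"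
  unfolding det_def by (intro continuous_intros assms)

lemma continuous_on_matrix_inv:
  fixes A :: "'a::topological_space \<Rightarrow> real^'n^'n"
  assumes A: "continuous_on S A" and inv: "\<And>t. t \<in> S \<Longrightarrow> invertible (A t)"
  shows "continuous_on S (\<lambda>t. matrix_inv (A t))"
proof -
  have comp: "continuous_on S (\<lambda>t. A t $ i $ j)" for i j
    by (intro continuous_on_component A)
  have "continuous_on S (\<lambda>t. matrix_inv (A t) $ k $ l)" for k l
  proof -
    have "continuous_on S (\<lambda>t. if j = k then axis l 1 $ i else A t $ i $ j)" for i j
      by (cases "j = k") (simp_all add: comp)
    then have "continuous_on S (\<lambda>t. det (\<chi> i j. if j = k then axis l 1 $ i else A t $ i $ j) / det (A t))"
      using inv by (intro continuous_on_divide continuous_on_det) (auto simp: invertible_det_nz comp)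
    then show ?thesis
      by (subst continuous_on_cong[OF refl matrix_inv_component]) (use inv in auto)
  qed
  then have "continuous_on S (\<lambda>t. \<chi> k. \<chi> l. matrix_inv (A t) $ k $ l)"
    by (intro continuous_on_vec_lambda)
  then show ?thesis by simp
qed

text \<open>The third conclusion serves uniqueness: any logarithm Y of A commutes with
  \<open>mexp Y\<close>, which is A, and hence with X, as \<open>principal_log_unique\<close>
  demands.\<close>

lemma principal_log_exists:
  fixes A :: "real^'n^'n"
  assumes nonpos: "\<And>c. c \<le> 0 \<Longrightarrow> \<not> eigenvalue A c"
  obtains X where "mexp X = A" "principal_spectrum X"
    "\<And>Y. Y ** A = A ** Y \<Longrightarrow> Y ** X = X ** Y"
proof -
  define C where "C = A - mat 1"
  \<comment> \<open>\<open>B\<close> runs along the segment from the identity to A, and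
    \<open>D\<close> is the logarithmic derivative of \<open>B\<close>.\<close>
  define B where "B t = mat 1 + t *\<^sub>R C" for t :: real
  define R where "R t = matrix_inv (B t)" for t
  define D where "D t = C ** R t" for t
  define F where "F s = integral {0..s} D" for s
  have Bv: "B t *v v = v + t *\<^sub>R (A *v v - v)" for t v
    by (simp add: B_def C_def matrix_vector_mult_add_rdistrib matrix_vector_mult_diff_rdistrib
        scaleR_matrix_vector_assoc[symmetric])
  \<comment> \<open>For t > 0 a nonzero kernel vector would be an eigenvector of A with eigenvalue
    (t - 1) / t, which is nonpositive; for t = 0 the matrix is the identity.\<close>
  have inv: "invertible (B t)" if t: "t \<in> {0..1}" for t
    unfolding invertible_left_inverse matrix_left_invertible_ker
  proof (intro allI impI)
    fix v assume "B t *v v = 0"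
    then have eq: "t *\<^sub>R (A *v v) = (t - 1) *\<^sub>R v"
      by (simp add: Bv algebra_simps)
    show "v = 0"
    proof (cases "t = 0")
      case False
      then have "A *v v = (1 / t) *\<^sub>R (t *\<^sub>R (A *v v))"
        by simp
      also have "\<dots> = ((t - 1) / t) *s v"
        unfolding eq by (simp add: scalar_mult_eq_scaleR)
      finally have "A *v v = ((t - 1) / t) *s v" .
      moreover have "(t - 1) / t \<le> 0"
        using t False by (simp add: divide_nonpos_pos)
      ultimately show ?thesis
        using nonpos by (auto simp: eigenvalue_def)
    qed (use eq in auto)
  qed
  have BR: "B t ** R t = mat 1" "R t ** B t = mat 1" if "t \<in> {0..1}" for t
    using matrix_inv_mult[OF inv[OF that]] by (simp_all add: R_def)
  have contB: "continuous_on {0..1} B"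
    unfolding B_def by (intro continuous_intros)
  have "continuous_on {0..1} R"
    unfolding R_def by (rule continuous_on_matrix_inv[OF contB inv])
  then have contD: "continuous_on {0..1} D"
    unfolding D_def by (intro matrix_mult.continuous_on continuous_on_const)
  have intD: "D integrable_on {0..s}" if "s \<in> {0..1}" for s
    using that by (intro integrable_continuous_interval continuous_on_subset[OF contD]) auto
  have F0: "F 0 = 0"
    by (simp add: F_def)
  have derivF: "(F has_vector_derivative D s) (at s within {0..1})" if "s \<in> {0..1}" for s
    unfolding F_def using contD that by (rule integral_has_vector_derivative)
  have commB: "Y ** B t = B t ** Y" if "Y ** A = A ** Y" for Y t
    by (simp add: B_def C_def matrix_mult.add_left matrix_mult.add_right matrix_mult.diff_left
        matrix_mult.diff_right matrix_mult.scaleR_left matrix_mult.scaleR_right that)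
  have commR: "Y ** R t = R t ** Y" if Y: "Y ** A = A ** Y" and t: "t \<in> {0..1}" for Y t
  proof -
    have "Y ** R t = R t ** (B t ** Y) ** R t"
      by (simp add: matrix_mul_assoc BR[OF t])
    also have "\<dots> = R t ** Y ** (B t ** R t)"
      by (simp add: commB[OF Y, symmetric] matrix_mul_assoc)
    finally show ?thesis by (simp add: BR[OF t])
  qed
  have commC: "Y ** C = C ** Y" if "Y ** A = A ** Y" for Y
    by (simp add: C_def matrix_mult.diff_left matrix_mult.diff_right that)
  have commD: "Y ** D t = D t ** Y" if Y: "Y ** A = A ** Y" and t: "t \<in> {0..1}" for Y t
  proof -
    have "Y ** D t = C ** (Y ** R t)"
      by (simp add: D_def matrix_mul_assoc commC[OF Y])
    then show ?thesis
      by (simp add: D_def commR[OF Y t] matrix_mul_assoc)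
  qed
  \<comment> \<open>Multiplication by Y on either side is linear and bounded, so it passes under the
    integral, where Y commutes with every \<open>D t\<close>.\<close>
  have commF: "Y ** F s = F s ** Y" if Y: "Y ** A = A ** Y" and s: "s \<in> {0..1}" for Y s
  proof -
    have "Y ** F s = integral {0..s} (\<lambda>t. Y ** D t)"
      unfolding F_def
      using integral_linear[OF intD[OF s] matrix_mult.bounded_linear_right[of Y]] by (simp add: o_def)
    also have "\<dots> = integral {0..s} (\<lambda>t. D t ** Y)"
      using s by (intro integral_cong commD[OF Y]) auto
    also have "\<dots> = F s ** Y"
      unfolding F_def
      using integral_linear[OF intD[OF s] matrix_mult.bounded_linear_left[of Y]] by (simp add: o_def)
    finally show ?thesis .
  qed
  have AF: "F s ** A = A ** F s" if "s \<in> {0..1}" for s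
    using commF[OF refl that] by (rule sym)
  \<comment> \<open>All values of F commute with each other, as each commutes with A, so the
    exponential can be differentiated. The two terms of the product rule cancel because
    \<open>D s ** B s = C\<close>.\<close>
  have deriv0: "((\<lambda>s. mexp (- F s) ** B s) has_vector_derivative 0) (at s within {0..1})"
    if s: "s \<in> {0..1}" for s
  proof -
    have "((\<lambda>t. - F t) has_vector_derivative - D s) (at s within {0..1})"
      by (intro has_vector_derivative_minus derivF s)
    then have E: "((\<lambda>t. mexp (- F t)) has_vector_derivative mexp (- F s) ** - D s) (at s within {0..1})"
      by (rule mexp_has_vector_derivative[OF _ s])
        (simp add: matrix_mult.minus_left matrix_mult.minus_right, rule commF[OF AF[OF s]], simp)
    have B': "(B has_vector_derivative C) (at s within {0..1})"
      unfolding B_def by (auto intro!: derivative_eq_intros)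
    have "D s ** B s = C"
      unfolding D_def by (simp add: matrix_mul_assoc[symmetric] BR[OF s])
    then have "mexp (- F s) ** C + mexp (- F s) ** - D s ** B s = 0"
      by (simp add: matrix_mult.minus_left matrix_mult.minus_right matrix_mul_assoc[symmetric])
    with matrix_mult.has_vector_derivative[OF E B'] show ?thesis
      by simp
  qed
  have "mexp (- F 0) ** B 0 = mexp (- F 1) ** B 1"
  proof -
    obtain c where c: "mexp (- F s) ** B s = c" if "s \<in> {0..1}" for s
      using has_vector_derivative_zero_constant[OF convex_real_interval(5) deriv0] by blast
    show ?thesis
      using c[of 0] c[of 1] by simp
  qed
  then have "mexp (- F 1) ** A = mat 1"
    by (simp add: F0 B_def C_def)
  then have "mexp (F 1) ** (mexp (- F 1) ** A) = mexp (F 1)"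
    by simp
  then have exp: "mexp (F 1) = A"
    by (simp add: matrix_mul_assoc mexp_minus)
  have "principal_spectrum (F 1)"
    unfolding principal_spectrum_def
  proof (intro allI impI)
    fix z assume "eigenvalue (complexify (F 1)) z"
    then obtain u where u: "u \<noteq> 0" "complexify (F 1) *v u = z *s u"
      by (auto simp: eigenvalue_def)
    \<comment> \<open>The eigenspace of \<open>F 1\<close> for z is invariant under A, so it
      contains an eigenvector v of A.\<close>
    have "complexify A *v w \<in> {v. complexify (F 1) *v v = z *s v}"
      if "w \<in> {v. complexify (F 1) *v v = z *s v}" for w
    proof -
      have "complexify (F 1) *v (complexify A *v w) = complexify A *v (complexify (F 1) *v w)"
        using AF[of 1] by (simp add: complexify_mult_vec[symmetric])
      with that show ?thesis by (simp add: vector_scalar_commute)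
    qed
    from eigenvector_in_invariant_subspace[OF subspace_eigenspace this, of u] u
    obtain l v where v: "v \<noteq> 0" "complexify (F 1) *v v = z *s v" "complexify A *v v = l *s v"
      by blast
    have l: "l \<notin> \<real>\<^sub>\<le>\<^sub>0"
      using nonpos eigenvalue_complexifyD v(1,3) by (auto elim!: nonpos_Reals_cases)
    \<comment> \<open>The segment from 1 to l avoids the branch cut of \<open>Ln\<close>: a point on
      the cut with t nonzero would make l real, hence positive, and then the point itself would be
      positive.\<close>
    have seg: "1 + of_real t * (l - 1) \<notin> \<real>\<^sub>\<le>\<^sub>0" if t: "t \<in> {0..1}" for t
    proof
      assume "1 + of_real t * (l - 1) \<in> \<real>\<^sub>\<le>\<^sub>0"
      then have 1: "1 + t * (Re l - 1) \<le> 0" "t * Im l = 0"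
        by (auto simp: complex_nonpos_Reals_iff)
      then have "t \<noteq> 0" by auto
      with 1 l have "Re l > 0"
        by (auto simp: complex_nonpos_Reals_iff)
      then have "0 < (1 - t) + t * Re l"
        using t \<open>t \<noteq> 0\<close> by (intro add_nonneg_pos mult_pos_pos) auto
      with 1 show False by (simp add: algebra_simps)
    qed
    have Dv: "complexify (D t) *v v = ((l - 1) / (1 + of_real t * (l - 1))) *s v"
      if t: "t \<in> {0..1}" for t
    proof -
      let ?d = "1 + of_real t * (l - 1)"
      have Cv: "complexify C *v v = (l - 1) *s v"
        by (simp add: C_def complexify_diff_vec complexify_one v(3) vec.scale_left_diff_distrib)
      have Bv: "complexify (B t) *v v = ?d *s v"
        by (simp add: B_def complexify_add_vec complexify_scaleR_vec complexify_one Cv)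
          (simp add: vec_eq_iff scaleR_conv_of_real[where 'a = complex] algebra_simps)
      have "?d \<noteq> 0"
        using seg[OF t] by auto
      have "v = complexify (R t) *v (complexify (B t) *v v)"
        by (simp add: complexify_mult_vec[symmetric] BR[OF t] complexify_one)
      then have "v = ?d *s (complexify (R t) *v v)"
        unfolding Bv vector_scalar_commute .
      then have "complexify (R t) *v v = (1 / ?d) *s v"
        using \<open>?d \<noteq> 0\<close> by (metis divide_self_if mult.commute times_divide_eq_left vec.scale_one vec.scale_scale
          mult_1)
      then show ?thesis
        unfolding D_def complexify_mult_vec by (simp only: vector_scalar_commute Cv vec.scale_scale) simp
    qed
    have "((\<lambda>t. complexify (D t) *v v) has_integral complexify (F 1) *v v) {0..1}"
      using has_integral_linear[OF integrable_integral[OF intD[of 1]] bounded_linear_complexify_mult_vec]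
      by (simp add: F_def o_def)
    then have 1: "((\<lambda>t. ((l - 1) / (1 + of_real t * (l - 1))) *s v) has_integral z *s v) {0..1}"
      unfolding v(2) by (rule has_integral_eq[rotated]) (simp add: Dv)
    \<comment> \<open>On v the integral defining \<open>F 1\<close> becomes a scalar one, with
      antiderivative \<open>Ln\<close> along the segment. As Ln 1 = 0, its value is Ln l.\<close>
    have "((\<lambda>t. (l - 1) / (1 + of_real t * (l - 1))) has_integral
        Ln (1 + of_real 1 * (l - 1)) - Ln (1 + of_real 0 * (l - 1))) {0..1}"
    proof (rule fundamental_theorem_of_calculus)
      fix t :: real assume "t \<in> {0..1}"
      then show "((\<lambda>t. Ln (1 + of_real t * (l - 1))) has_vector_derivative
          (l - 1) / (1 + of_real t * (l - 1))) (at t within {0..1})"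
        using seg[of t]
        by (auto intro!: derivative_eq_intros has_vector_derivative_real_field
            simp: divide_simps)
    qed simp
    from has_integral_linear[OF this bounded_linear_vector_scalar_mult_left]
    have "((\<lambda>t. ((l - 1) / (1 + of_real t * (l - 1))) *s v) has_integral Ln l *s v) {0..1}"
      by (simp add: o_def)
    with 1 have "z *s v = Ln l *s v"
      by (rule has_integral_unique)
    with v(1) have z: "z = Ln l"
      by simp
    \<comment> \<open>The imaginary part of \<open>Ln\<close> lies in (-pi, pi], and pi is attained
      only at negative reals, which l is not.\<close>
    have "l \<noteq> 0" using l by auto
    then show "- pi < Im z \<and> Im z < pi"
      unfolding z using mpi_less_Im_Ln[of l] Im_Ln_le_pi[of l] Im_Ln_eq_pi[of l] l
      by (auto simp: complex_nonpos_Reals_iff less_le)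
  qed
  with exp commF show thesis
    by (intro that[of "F 1"]) auto
qed

section \<open>The principal logarithm of an inverse\<close>

lemma mlog_eq_The: "mlog A = (THE X. mexp X = A \<and> principal_spectrum X)"
  by (simp add: mlog_def principal_spectrum_def)

text \<open>The strip of admissible eigenvalues is symmetric about 0, so negation exchanges the
  principal logarithms of A and of its inverse B. Existence and uniqueness for A thus carry over to
  B.\<close>

lemma mlog_inverse:
  fixes A B :: "real^'n^'n"
  assumes nonpos: "\<And>c. c \<le> 0 \<Longrightarrow> \<not> eigenvalue A c" and AB: "A ** B = mat 1"
  shows "mlog B = - mlog A"
proof -
  obtain X where X: "mexp X = A" "principal_spectrum X"
    and comm: "\<And>Y. Y ** A = A ** Y \<Longrightarrow> Y ** X = X ** Y"
    using principal_log_exists[OF nonpos] by metis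
  have unique: "Y = X" if "mexp Y = A" "principal_spectrum Y" for Y
    using principal_log_unique[of X Y] comm[of Y] mexp_commute[of Y] that X by simp
  have minus: "complexify (- Y) *v v = - (complexify Y *v v)" for Y :: "real^'n^'n" and v
    using complexify_scaleR_vec[of "-1" Y v] by simp
  have spec: "principal_spectrum (- Y)" if "principal_spectrum Y" for Y :: "real^'n^'n"
    unfolding principal_spectrum_def
  proof (intro allI impI)
    fix z assume "eigenvalue (complexify (- Y)) z"
    then obtain v where "v \<noteq> 0" "- (complexify Y *v v) = z *s v"
      by (auto simp: eigenvalue_def minus)
    then have "complexify Y *v v = (- z) *s v"
      by (metis minus_minus vec.scale_minus_left)
    with \<open>v \<noteq> 0\<close> that have "- pi < Im (- z)" "Im (- z) < pi"
      unfolding principal_spectrum_def eigenvalue_def by blast+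
    then show "- pi < Im z \<and> Im z < pi" by simp
  qed
  have inv: "mexp (- Y) = V" if "mexp Y ** V = mat 1" for Y V :: "real^'n^'n"
  proof -
    have "mexp (- Y) = mexp (- Y) ** (mexp Y ** V)"
      by (simp add: that)
    then show ?thesis
      by (simp add: matrix_mul_assoc mexp_minus)
  qed
  have BA: "B ** A = mat 1"
    using AB matrix_left_right_inverse by blast
  have "mlog A = X"
    unfolding mlog_eq_The by (rule the_equality) (use X unique in blast)+
  moreover have "mlog B = - X"
    unfolding mlog_eq_The
  proof (rule the_equality)
    show "mexp (- X) = B \<and> principal_spectrum (- X)"
      using inv[of X B] X AB spec[OF X(2)] by simp
    fix Y assume "mexp Y = B \<and> principal_spectrum Y"
    then have "mexp (- Y) = A" "principal_spectrum (- Y)"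
      using inv[of Y A] BA spec[of Y] by auto
    from unique[OF this] show "Y = - X" by (metis minus_minus)
  qed
  ultimately show ?thesis by simp
qed

section \<open>The interpolant\<close>

lemma sigJ_mult_sigJ [simp]: "sigJ p ** sigJ p = mat 1"
proof -
  have "(\<Sum>k\<in>UNIV. sigJ p $ i $ k * sigJ p $ k $ j)
      = (\<Sum>k\<in>UNIV. if k = i then if i = j then 1 else 0 else 0)" for i j :: 'a
    by (rule sum.cong) (auto simp: sigJ_def)
  then show ?thesis
    by (simp add: vec_eq_iff matrix_matrix_mult_def mat_def)
qed

lemma eigenvalue_0_iff: "eigenvalue A 0 \<longleftrightarrow> \<not> invertible A" for A :: "'a::field^'n^'n"
  unfolding invertible_left_inverse matrix_left_invertible_ker eigenvalue_def by auto

theorem lemma4p2: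
  fixes p q m :: nat
    and \<Omega> :: "(real^'d) set"
    and pt :: "nat \<Rightarrow> real^'d"
    and \<phi> :: "nat \<Rightarrow> real^'d \<Rightarrow> real"
    and L L' :: "nat \<Rightarrow> real^('n::{finite,linorder})^('n::{finite,linorder})"
  assumes "p + q = CARD('n::{finite,linorder})"
    and "open \<Omega>" and "connected \<Omega>" and "\<Omega> \<noteq> {}"
    and "\<And>j. j \<in> {1..m} \<Longrightarrow> pt j \<in> \<Omega>"
    and "\<And>i j. i \<in> {1..m} \<Longrightarrow> j \<in> {1..m} \<Longrightarrow> \<phi> i (pt j) = (if i = j then 1 else 0)"
    and "\<And>i. i \<in> {1..m} \<Longrightarrow> L i \<in> calL_star p q"
    and "\<And>i. i \<in> {1..m} \<Longrightarrow> L' i = sigJ p ** matrix_inv (L i) ** sigJ p"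
  shows "\<forall>x\<in>\<Omega>. interpolant p m \<phi> L' x
           = sigJ p ** matrix_inv (interpolant p m \<phi> L x) ** sigJ p"
proof
  fix x
  let ?J = "sigJ p :: real^('n::{finite,linorder})^('n::{finite,linorder})"
  have log: "mlog (L' i ** ?J) = - mlog (L i ** ?J)" if i: "i \<in> {1..m}" for i
  proof (rule mlog_inverse)
    have neg: "\<not> eigenvalue (L i ** ?J) c" if "c < 0" for c
      using assms(7)[OF i] that by (auto simp: calL_star_def)
    have inv: "invertible (L i)"
      using assms(7)[OF i] by (auto simp: calL_star_def calL_def)
    \<comment> \<open>The last factor J of \<open>L' i\<close> cancels, and the result is the
      inverse of \<open>L i ** ?J\<close>.\<close>
    have "L' i ** ?J = ?J ** matrix_inv (L i)"
      by (simp add: assms(8)[OF i] matrix_mul_assoc[symmetric])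
    then have "L i ** ?J ** (L' i ** ?J) = L i ** (?J ** ?J) ** matrix_inv (L i)"
      by (simp only: matrix_mul_assoc)
    then show "L i ** ?J ** (L' i ** ?J) = mat 1"
      by (simp add: matrix_inv_mult inv)
    then have "invertible (L i ** ?J)"
      by (auto simp: invertible_right_inverse)
    \<comment> \<open>Membership in \<open>calL_star\<close> rules out negative eigenvalues only;
      the eigenvalue 0 is excluded by invertibility.\<close>
    then show "\<not> eigenvalue (L i ** ?J) c" if "c \<le> 0" for c
      using neg[of c] that by (cases "c = 0") (auto simp: eigenvalue_0_iff)
  qed
  define S where "S = (\<Sum>i=1..m. \<phi> i x *\<^sub>R mlog (L i ** ?J))"
  have "(\<Sum>i=1..m. \<phi> i x *\<^sub>R mlog (L' i ** ?J)) = - S"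
    by (simp add: S_def log sum_negf)
  then have L': "interpolant p m \<phi> L' x = mexp (- S) ** ?J"
    by (simp add: interpolant_def)
  \<comment> \<open>The inverse of \<open>mexp S ** ?J\<close> begins with J, so multiplying it by J
    on the left leaves \<open>mexp (- S)\<close>, and the J on the right is the one in the
    interpolant of \<open>L'\<close>.\<close>
  have "mexp S ** ?J ** (?J ** mexp (- S)) = mexp S ** (?J ** ?J) ** mexp (- S)"
    by (simp only: matrix_mul_assoc)
  then have "matrix_inv (mexp S ** ?J) = ?J ** mexp (- S)"
    by (intro matrix_inv_unique) (simp add: mexp_minus)
  moreover have "interpolant p m \<phi> L x = mexp S ** ?J"
    by (simp only: interpolant_def S_def)
  ultimately have "?J ** matrix_inv (interpolant p m \<phi> L x) ** ?J = ?J ** ?J ** mexp (- S) ** ?J"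
    by (simp add: matrix_mul_assoc)
  then show "interpolant p m \<phi> L' x = ?J ** matrix_inv (interpolant p m \<phi> L x) ** ?J"
    by (simp add: L')
qed

end
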